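(* Let $K\ge 1$ be an integer, let $y\in\mathbb{R}^n$, and let $H,D\in\mathbb{R}^{n\times n}$ be such that $H^\top H$ and $D^\top D$ are diagonalizable in a same basis $\mathcal{P}$. For every $k\in\{0,\ldots,K-1\}$ let $\mu_k,\gamma_k,\lambda_k$ be positive real numbers, and set $$W_k=\mathbb{I}_n-\gamma_k\left(H^\top H+\lambda_kD^\top D\right),\qquad b_k=\gamma_kH^\top y,\qquad R_k=\mathrm{prox}_{\gamma_k\mu_k\mathcal{B}},$$ where $\mathcal{B}$ is the logarithmic barrier of a feasible set $\mathcal{C}$ as described in the context. Let $(\theta_k)_{-1\le k\le K-1}$ be defined from $(W_k)_{0\le k\le K-1}$ as in the context. Let $\alpha\in[1/2,1]$. Let $\beta_-$ and $\beta_+$ be the smallest and largest eigenvalues of $W=W_{K-1}\circ\cdots\circ W_0$, respectively. For every $p\in\{1,\ldots,n\}$ and every $k\in\{0,\ldots,K-1\}$, let $$\beta_k^{(p)}=1-\gamma_k\left(\beta_H^{(p)}+\lambda_k\beta_D^{(p)}\right),$$ where $\beta_H^{(p)}$ and $\beta_D^{(p)}$ denote the $p$-th eigenvalue of $H^\top H$ and $D^\top D$ in $\mathcal{P}$, respectively (i.e., the eigenvalues associated with the $p$-th vector of $\mathcal{P}$). Then $$\beta_-=\min_{1\le p\le n}\prod_{k=0}^{K-1}\beta_k^{(p)},\qquad \beta_+=\max_{1\le p\le n}\prod_{k=0}^{K-1}\beta_k^{(p)},$$ and, for every $k\in\{0,\ldots,K-1\}$, $$\theta_k=\sum_{l=0}^{k}\theta_{l-1}\max_{1\le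 q_l\le n}\left|\beta_k^{(q_l)}\cdots\beta_l^{(q_l)}\right|.$$ In addition, if one of the following conditions is satisfied: (i) $\beta_++\beta_-\le 0$ and $\theta_{K-1}\le 2^{K-1}(2\alpha-1)$; (ii) $0\le\beta_++\beta_-\le 2^{K+1}(1-\alpha)$ and $2\theta_{K-1}\le\beta_++\beta_-+2^K(2\alpha-1)$; (iii) $2^{K+1}(1-\alpha)\le\beta_++\beta_-$ and $\theta_{K-1}\le 2^{K-1}$; then the operator $R_{K-1}\circ(W_{K-1}\cdot+b_{K-1})\circ\cdots\circ R_0\circ(W_0\cdot+b_0)$ from $\mathbb{R}^n$ to $\mathbb{R}^n$ is $\alpha$-averaged.
   Context: $\mathbb{I}_n$ is the identity matrix; $\|\cdot\|$ is the Euclidean norm for vectors and the spectral norm for matrices; matrices are identified with linear operators. Barrier. $\Gamma_0(\mathbb{R}^n)$ is the set of proper, convex, lower semicontinuous functions from $\mathbb{R}^n$ to $\mathbb{R}\cup\{+\infty\}$. The feasible set is $\mathcal{C}=\{x\in\mathbb{R}^n\mid (\forall i\in\{1,\ldots,r\})\ c_i(x)\ge 0\}$, where $-c_i\in\Gamma_0(\mathbb{R}^n)$ for each $i$, and its strict interior $\mathrm{int}\,\mathcal{C}=\{x\in\mathbb{R}^n\mid(\forall i\in\{1,\ldots,r\})\ c_i(x)>0\}$ is assumed nonempty. The logarithmic barrier is $\mathcal{B}(x)=-\sum_{i=1}^{r}\ln(c_i(x))$ if $x\in\mathrm{int}\,\mathcal{C}$ and $\mathcal{B}(x)=+\infty$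 otherwise. Proximity operator. For $g\in\Gamma_0(\mathbb{R}^n)$ and $t>0$, $\mathrm{prox}_{tg}(x)=\operatorname{argmin}_{u\in\mathbb{R}^n}\ \frac12\|x-u\|^2+t\,g(u)$ (the unique minimizer). Constants $\theta_k$. Set $\theta_{-1}=1$ and, for every $k\in\{0,\ldots,K-1\}$, $$\theta_k=\|W_k\circ\cdots\circ W_0\|+\sum_{\ell=0}^{k-1}\ \sum_{0\le j_0<\cdots<j_\ell\le k-1}\|W_k\circ\cdots\circ W_{j_\ell+1}\|\,\|W_{j_\ell}\circ\cdots\circ W_{j_{\ell-1}+1}\|\cdots\|W_{j_0}\circ\cdots\circ W_0\|$$ (the double sum is empty for $k=0$). Averagedness. An operator $T:\mathbb{R}^n\to\mathbb{R}^n$ is nonexpansive if it is $1$-Lipschitz. For $\alpha\in[0,1]$, $T$ is $\alpha$-averaged if there exists a nonexpansive operator $R:\mathbb{R}^n\to\mathbb{R}^n$ such that $T=(1-\alpha)I_n+\alpha R$, where $I_n$ is the identity operator of $\mathbb{R}^n$. *)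

theory Defs
  imports "HOL-Analysis.Analysis"
begin

text \<open>
  Convexity is only required for \<open>0 < t < 1\<close>, so the convention \<open>0 * \<infinity> = 0\<close> of
  \<^typ>\<open>ereal\<close> never enters; no sum \<open>\<infinity> + (-\<infinity>)\<close> arises for a proper function.
\<close>

definition proper_fun :: "('a \<Rightarrow> ereal) \<Rightarrow> bool" where
  "proper_fun f \<longleftrightarrow> (\<forall>x. f x \<noteq> -\<infinity>) \<and> (\<exists>x. f x \<noteq> \<infinity>)"

definition convex_fun :: "('a::real_vector \<Rightarrow> ereal) \<Rightarrow> bool" where
  "convex_fun f \<longleftrightarrow> (\<forall>x y t. 0 < t \<and> t < 1 \<longrightarrow>
     f ((1 - t) *\<^sub>R x + t *\<^sub>R y) \<le> ereal (1 - t) * f x + ereal t * f y)"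

definition lower_semicontinuous :: "('a::topological_space \<Rightarrow> ereal) \<Rightarrow> bool" where
  "lower_semicontinuous f \<longleftrightarrow> (\<forall>x. f x \<le> Liminf (at x) f)"

definition Gamma0 :: "('a::euclidean_space \<Rightarrow> ereal) set" where
  "Gamma0 = {f. proper_fun f \<and> convex_fun f \<and> lower_semicontinuous f}"

text \<open>The strict interior is the set of strictly feasible points, not the topological
  interior of the feasible set.\<close>

definition strict_interior :: "nat \<Rightarrow> (nat \<Rightarrow> 'a \<Rightarrow> ereal) \<Rightarrow> 'a set" where
  "strict_interior r c = {x. \<forall>i\<in>{1..r}. c i x > 0}"

text \<open>When \<open>- c i\<close> is proper, \<open>c i x\<close> is a positive real number for every strictly
  feasible \<open>x\<close>, so \<^const>\<open>real_of_ereal\<close> loses nothing in the first branch.\<close>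

definition log_barrier :: "nat \<Rightarrow> (nat \<Rightarrow> 'a \<Rightarrow> ereal) \<Rightarrow> 'a \<Rightarrow> ereal" where
  "log_barrier r c x =
     (if x \<in> strict_interior r c then ereal (- (\<Sum>i=1..r. ln (real_of_ereal (c i x)))) else \<infinity>)"

text \<open>\<open>prox t g\<close> is the proximity operator of \<open>t g\<close>.\<close>

definition prox :: "real \<Rightarrow> ('a::real_normed_vector \<Rightarrow> ereal) \<Rightarrow> 'a \<Rightarrow> 'a" where
  "prox t g x =
     (THE u. is_arg_min (\<lambda>u. ereal (1/2 * (norm (x - u))\<^sup>2) + ereal t * g u) (\<lambda>_. True) u)"

text \<open>\<open>compose_range T l k\<close> is \<open>T k \<circ> \<dots> \<circ> T l\<close>, for \<open>l \<le> k\<close>.\<close>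

definition compose_range :: "(nat \<Rightarrow> 'a \<Rightarrow> 'a) \<Rightarrow> nat \<Rightarrow> nat \<Rightarrow> 'a \<Rightarrow> 'a" where
  "compose_range T l k = fold (\<lambda>j f. T j \<circ> f) [l..<Suc k] id"

text \<open>In the inner sum, \<open>js\<close> is the tuple \<open>0 \<le> j\<^sub>0 < \<dots> < j\<^sub>m \<le> k - 1\<close>, as a list of
  length \<open>m + 1\<close>. For linear operators of Euclidean space, \<^const>\<open>onorm\<close> is the spectral
  norm.\<close>

definition theta_nat :: "(nat \<Rightarrow> 'a::real_normed_vector \<Rightarrow> 'a) \<Rightarrow> nat \<Rightarrow> real" where
  "theta_nat W k =
     onorm (compose_range W 0 k) +
     (\<Sum>m<k. \<Sum>js | length js = Suc m \<and> sorted_wrt (<) js \<and> set js \<subseteq> {..<k}.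
        onorm (compose_range W (js ! m + 1) k) *
        (\<Prod>i=1..m. onorm (compose_range W (js ! (i - 1) + 1) (js ! i))) *
        onorm (compose_range W 0 (js ! 0)))"

text \<open>The index is an integer because the sequence starts at \<open>-1\<close>.\<close>

definition theta :: "(nat \<Rightarrow> 'a::real_normed_vector \<Rightarrow> 'a) \<Rightarrow> int \<Rightarrow> real" where
  "theta W k = (if k < 0 then 1 else theta_nat W (nat k))"

definition nonexpansive :: "('a::real_normed_vector \<Rightarrow> 'a) \<Rightarrow> bool" where
  "nonexpansive T \<longleftrightarrow> 1-lipschitz_on UNIV T"

definition averaged :: "real \<Rightarrow> ('a::real_normed_vector \<Rightarrow> 'a) \<Rightarrow> bool" where
  "averaged \<alpha> T \<longleftrightarrow> 0 \<le> \<alpha> \<and> \<alpha> \<le> 1 \<and>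
     (\<exists>R. nonexpansive R \<and> T = (\<lambda>x. (1 - \<alpha>) *\<^sub>R x + \<alpha> *\<^sub>R R x))"

definition eigenvalues :: "('a::real_vector \<Rightarrow> 'a) \<Rightarrow> real set" where
  "eigenvalues f = {e. \<exists>v. v \<noteq> 0 \<and> f v = e *\<^sub>R v}"

definition is_basis :: "('i \<Rightarrow> 'a::real_vector) \<Rightarrow> bool" where
  "is_basis P \<longleftrightarrow> inj P \<and> independent (range P) \<and> span (range P) = UNIV"

text \<open>The matrix \<open>A\<close> is diagonal in the basis \<open>P\<close>, and \<open>d p\<close> is its eigenvalue associated
  with the vector \<open>P p\<close>.\<close>

definition diagonal_in_basis ::
    "real^'n^'n \<Rightarrow> ('n \<Rightarrow> real^'n) \<Rightarrow> ('n \<Rightarrow> real) \<Rightarrow> bool" where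
  "diagonal_in_basis A P d \<longleftrightarrow> is_basis P \<and> (\<forall>p. A *v P p = d p *\<^sub>R P p)"

end

theory Submission
  imports Defs
begin

text \<open>
  The proximity step of each layer is \<open>R k = (Id + Q k) / 2\<close> with \<open>Q k\<close> nonexpansive
  (\<open>prox_averaged\<close>, applicable to the barrier by \<open>log_barrier_Gamma0\<close>). Follow two inputs whose
  difference is \<open>\<delta>\<close>. After layer \<open>k\<close> the difference is half of the difference before \<open>R k\<close>,
  plus half of a vector that is no longer than it. Unrolling this over the \<open>K\<close> layers, the
  output difference multiplied by \<open>2 ^ K\<close> is \<open>W \<delta>\<close> plus error vectors, the one of layer \<open>j\<close>
  being transported by \<open>W (K - 1) \<circ> \<dots> \<circ> W (j + 1)\<close>. Grouping the index tuples in the definition of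
  \<open>\<theta>\<close> by their last entry gives \<open>\<theta>\<close> the same recursion as the one that bounds these errors
  (\<open>theta_nat_rec\<close>), so the error of layer \<open>j\<close> has norm at most \<open>\<theta> j * norm \<delta>\<close>. Being
  \<open>\<alpha>\<close>-averaged means that the output difference stays within \<open>\<alpha> * norm \<delta>\<close> of \<open>(1 - \<alpha>) \<delta>\<close>, so it
  follows (\<open>layers_averaged\<close>) from
  \<open>\<parallel>W - 2 ^ K (1 - \<alpha>) Id\<parallel> - \<parallel>W\<parallel> + 2 * \<theta> (K - 1) \<le> 2 ^ K * \<alpha>\<close>.

  It remains to read off spectral norms. Each \<open>W k\<close> is symmetric and diagonal in the basis \<open>P\<close>,
  hence so are the products of the \<open>W k\<close>. The basis need not be orthogonal, but its vectors for
  distinct eigenvalues of a symmetric operator are, which is enough for the norm to be the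
  largest modulus of an eigenvalue (\<open>onorm_symmetric_diagonal\<close>). This yields the formulas for
  \<open>\<beta>minus\<close>, \<open>\<beta>plus\<close> and \<open>\<theta>\<close>. In the sufficient inequality \<open>\<parallel>W\<parallel>\<close> is \<open>- \<beta>minus\<close> or \<open>\<beta>plus\<close>
  according to the sign of \<open>\<beta>plus + \<beta>minus\<close>, and \<open>\<parallel>W - 2 ^ K (1 - \<alpha>) Id\<parallel>\<close> is
  \<open>2 ^ K (1 - \<alpha>) - \<beta>minus\<close> or \<open>\<beta>plus - 2 ^ K (1 - \<alpha>)\<close> according to which side of the midpoint
  of \<open>\<beta>minus\<close> and \<open>\<beta>plus\<close> the number \<open>2 ^ K (1 - \<alpha>)\<close> lies on. Three of the four combinations
  occur, one for each condition of the theorem.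
\<close>

section \<open>Compositions of consecutive operators\<close>

lemma compose_range_self: "compose_range T k k = T k"
  by (simp add: compose_range_def)

lemma compose_range_empty: "compose_range T (Suc k) k = id"
  by (simp add: compose_range_def)

lemma compose_range_Suc:
  "l \<le> Suc k \<Longrightarrow> compose_range T l (Suc k) = T (Suc k) \<circ> compose_range T l k"
  by (simp add: compose_range_def)

lemma linear_compose_range:
  assumes "l \<le> k" "\<And>j. l \<le> j \<Longrightarrow> j \<le> k \<Longrightarrow> linear (T j)"
  shows "linear (compose_range T l k)"
  using assms
proof (induction k rule: dec_induct)
  case base
  then show ?case by (simp add: compose_range_self)
next
  case (step k)
  have "linear (T (Suc k) \<circ> compose_range T l k)"
    by (intro linear_compose) (use step in auto)
  then show ?case using step.hyps by (simp add: compose_range_Suc o_def)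
qed

section \<open>Symmetric operators diagonal in a common basis\<close>

text \<open>
  The basis \<open>P\<close> is not assumed orthogonal, so an operator that is diagonal in it need not be
  symmetric. Symmetry is what links the norm of the operator to its eigenvalues.
\<close>

definition symmetric_diagonal :: "('i \<Rightarrow> 'a::real_inner) \<Rightarrow> ('i \<Rightarrow> real) \<Rightarrow> ('a \<Rightarrow> 'a) \<Rightarrow> bool"
  where "symmetric_diagonal P d f \<longleftrightarrow>
    linear f \<and> (\<forall>x y. f x \<bullet> y = x \<bullet> f y) \<and> (\<forall>p. f (P p) = d p *\<^sub>R P p)"

lemma basis_expansion:
  fixes P :: "'i::finite \<Rightarrow> 'a::real_vector"
  assumes "is_basis P"
  obtains a where "x = (\<Sum>p\<in>UNIV. a p *\<^sub>R P p)"
proof -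
  have "x \<in> span (range P)" "inj P" using assms by (auto simp: is_basis_def)
  then obtain u where "x = (\<Sum>v\<in>range P. u v *\<^sub>R v)"
    by (auto simp: span_finite)
  then have "x = (\<Sum>p\<in>UNIV. u (P p) *\<^sub>R P p)"
    using \<open>inj P\<close> by (simp add: sum.reindex)
  then show ?thesis by (rule that)
qed

lemma basis_coefficient_zero:
  fixes P :: "'i::finite \<Rightarrow> 'a::real_vector"
  assumes "is_basis P" "(\<Sum>p\<in>UNIV. a p *\<^sub>R P p) = 0"
  shows "a p = 0"
proof -
  have inj: "inj P" and ind: "independent (range P)" using assms by (auto simp: is_basis_def)
  have "(\<Sum>v\<in>range P. a (inv P v) *\<^sub>R v) = 0"
    using assms(2) inj by (simp add: sum.reindex)
  from independentD[OF ind finite_imageI[OF finite] subset_refl this, of "P p"]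
  show ?thesis using inj by simp
qed

lemma basis_nonzero: "is_basis P \<Longrightarrow> P p \<noteq> 0"
  unfolding is_basis_def by (metis dependent_zero rangeI)

lemma linear_eq_on_basis:
  fixes P :: "'i \<Rightarrow> 'a::real_vector"
  assumes "is_basis P" "linear f" "linear g" "\<And>p. f (P p) = g (P p)"
  shows "f = g"
proof
  fix x
  have "x \<in> span (range P)" using assms(1) by (simp add: is_basis_def)
  then show "f x = g x"
    by (rule linear_eq_on[OF assms(2,3)]) (use assms(4) in auto)
qed

text \<open>
  A product of symmetric operators is symmetric when they commute, and operators that are
  diagonal in the same basis commute.
\<close>

lemma symmetric_diagonal_compose:
  assumes "is_basis P" "symmetric_diagonal P d f" "symmetric_diagonal P e g"
  shows "symmetric_diagonal P (\<lambda>p. d p * e p) (f \<circ> g)"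
proof -
  have lin: "linear f" "linear g"
    and sym: "\<And>x y. f x \<bullet> y = x \<bullet> f y" "\<And>x y. g x \<bullet> y = x \<bullet> g y"
    and diag: "\<And>p. f (P p) = d p *\<^sub>R P p" "\<And>p. g (P p) = e p *\<^sub>R P p"
    using assms by (auto simp: symmetric_diagonal_def)
  have "f \<circ> g = g \<circ> f"
    by (rule linear_eq_on_basis[OF assms(1)])
       (auto intro!: linear_compose simp: lin diag linear_scale mult.commute)
  then have comm: "g (f x) = f (g x)" for x by (metis comp_apply)
  have "linear (f \<circ> g)" using lin by (auto intro: linear_compose)
  then show ?thesis
    by (auto simp: symmetric_diagonal_def sym diag comm linear_scale lin mult.commute)
qed

lemma symmetric_diagonal_compose_range:
  assumes "is_basis P" "l \<le> k"
    and "\<And>j. l \<le> j \<Longrightarrow> j \<le> k \<Longrightarrow> symmetric_diagonal P (d j) (T j)"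
  shows "symmetric_diagonal P (\<lambda>p. \<Prod>j=l..k. d j p) (compose_range T l k)"
  using assms(2,3)
proof (induction k rule: dec_induct)
  case base
  then show ?case by (simp add: compose_range_self)
next
  case (step k)
  have "symmetric_diagonal P (\<lambda>p. d (Suc k) p * (\<Prod>j=l..k. d j p)) (T (Suc k) \<circ> compose_range T l k)"
    using step by (intro symmetric_diagonal_compose assms(1)) auto
  then show ?case using step.hyps by (simp add: compose_range_Suc prod.nat_ivl_Suc' mult.commute o_def)
qed

lemma symmetric_diagonal_shift:
  assumes "symmetric_diagonal P d f"
  shows "symmetric_diagonal P (\<lambda>p. d p - c) (\<lambda>x. f x - c *\<^sub>R x)"
  using assms
  by (auto simp: symmetric_diagonal_def inner_diff_left inner_diff_right scaleR_diff_left
      intro!: linear_compose_sub linear_scaleR)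

lemma eigenvalues_diagonal:
  fixes P :: "'i::finite \<Rightarrow> 'a::real_inner"
  assumes "is_basis P" "symmetric_diagonal P d f"
  shows "eigenvalues f = range d"
proof
  have lin: "linear f" and diag: "\<And>p. f (P p) = d p *\<^sub>R P p"
    using assms by (auto simp: symmetric_diagonal_def)
  show "range d \<subseteq> eigenvalues f"
    using basis_nonzero[OF assms(1)] diag by (auto simp: eigenvalues_def)
  show "eigenvalues f \<subseteq> range d"
  proof
    fix e assume "e \<in> eigenvalues f"
    then obtain v where v: "v \<noteq> 0" "f v = e *\<^sub>R v" by (auto simp: eigenvalues_def)
    obtain a where a: "v = (\<Sum>p\<in>UNIV. a p *\<^sub>R P p)" using basis_expansion[OF assms(1)] .
    have "(\<Sum>p\<in>UNIV. (a p * (d p - e)) *\<^sub>R P p) = f v - e *\<^sub>R v"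
      by (simp add: a linear_sum[OF lin] linear_scale[OF lin] diag scaleR_sum_right
          sum_subtractf[symmetric] algebra_simps)
    then have "a p * (d p - e) = 0" for p
      using v(2) basis_coefficient_zero[OF assms(1), of "\<lambda>p. a p * (d p - e)"] by simp
    moreover obtain p where "a p \<noteq> 0"
    proof (rule ccontr)
      assume "\<not> thesis"
      then have "\<forall>p. a p = 0" using that by blast
      then show False using v(1) a by simp
    qed
    ultimately have "e = d p" by auto
    then show "e \<in> range d" by blast
  qed
qed

text \<open>
  Expand \<open>M\<^sup>2 * (norm x)\<^sup>2 - (norm (f x))\<^sup>2\<close> in the basis. The Gram coefficient \<open>P p \<bullet> P q\<close>
  comes with the factor \<open>M\<^sup>2 - d p * d q\<close>, and it vanishes unless \<open>d p = d q\<close>, by symmetry of \<open>f\<close>.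
  So the factor can be replaced by \<open>s p * s q\<close> with \<open>s p = sqrt (M\<^sup>2 - (d p)\<^sup>2)\<close>, which turns the
  expression into the squared norm of a vector. This avoids passing to an orthonormal basis.
\<close>

lemma norm_symmetric_diagonal_le:
  fixes P :: "'i::finite \<Rightarrow> 'a::real_inner"
  assumes "is_basis P" "symmetric_diagonal P d f" "\<And>p. \<bar>d p\<bar> \<le> M"
  shows "norm (f x) \<le> M * norm x"
proof -
  have lin: "linear f" and sym: "\<And>x y. f x \<bullet> y = x \<bullet> f y" and diag: "\<And>p. f (P p) = d p *\<^sub>R P p"
    using assms by (auto simp: symmetric_diagonal_def)
  have orth: "P p \<bullet> P q = 0" if "d p \<noteq> d q" for p q
    using sym[of "P p" "P q"] that by (simp add: diag)
  obtain a where a: "x = (\<Sum>p\<in>UNIV. a p *\<^sub>R P p)" using basis_expansion[OF assms(1)] .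
  have "M \<ge> 0" using assms(3)[of undefined] by linarith
  define s where "s p = sqrt (M\<^sup>2 - (d p)\<^sup>2)" for p
  have s2: "s p * s p = M\<^sup>2 - (d p)\<^sup>2" for p
    using abs_le_square_iff[of "d p" M] assms(3)[of p] \<open>M \<ge> 0\<close> by (simp add: s_def)
  have weight: "(M\<^sup>2 - d p * d q) * (P p \<bullet> P q) = (s p * s q) * (P p \<bullet> P q)" for p q
  proof (cases "d p = d q")
    case True
    then have "s p * s q = s p * s p" by (simp add: s_def)
    then show ?thesis using True s2[of p] by (simp add: power2_eq_square)
  qed (simp add: orth)
  have quad: "(\<Sum>p\<in>UNIV. u p *\<^sub>R P p) \<bullet> (\<Sum>p\<in>UNIV. u p *\<^sub>R P p)
      = (\<Sum>p\<in>UNIV. \<Sum>q\<in>UNIV. u p * u q * (P p \<bullet> P q))" for u :: "'i \<Rightarrow> real"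
    by (simp add: inner_sum_left inner_sum_right sum_distrib_left mult.assoc)
       (rule sum.swap[THEN trans], auto intro!: sum.cong simp: inner_commute mult_ac)
  have fx: "f x = (\<Sum>p\<in>UNIV. (a p * d p) *\<^sub>R P p)"
    by (simp add: a linear_sum[OF lin] linear_scale[OF lin] diag)
  have xx: "x \<bullet> x = (\<Sum>p\<in>UNIV. \<Sum>q\<in>UNIV. a p * a q * (P p \<bullet> P q))"
    by (simp only: a quad)
  have ffx: "f x \<bullet> f x = (\<Sum>p\<in>UNIV. \<Sum>q\<in>UNIV. (a p * d p) * (a q * d q) * (P p \<bullet> P q))"
    by (simp only: fx quad)
  have "M\<^sup>2 * (x \<bullet> x) - f x \<bullet> f x
      = (\<Sum>p\<in>UNIV. \<Sum>q\<in>UNIV. a p * a q * ((M\<^sup>2 - d p * d q) * (P p \<bullet> P q)))"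
    unfolding xx ffx by (simp add: sum_distrib_left sum_subtractf[symmetric] algebra_simps)
  also have "\<dots> = (\<Sum>p\<in>UNIV. (a p * s p) *\<^sub>R P p) \<bullet> (\<Sum>p\<in>UNIV. (a p * s p) *\<^sub>R P p)"
    unfolding weight quad by (simp add: mult_ac)
  also have "\<dots> \<ge> 0" by simp
  finally have "(norm (f x))\<^sup>2 \<le> (M * norm x)\<^sup>2"
    by (simp add: power_mult_distrib power2_norm_eq_inner)
  then show ?thesis
    by (rule power2_le_imp_le) (use \<open>M \<ge> 0\<close> in simp)
qed

lemma onorm_symmetric_diagonal:
  fixes P :: "'i::finite \<Rightarrow> 'a::euclidean_space"
  assumes "is_basis P" "symmetric_diagonal P d f"
  shows "onorm f = (MAX p. \<bar>d p\<bar>)"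
proof (rule antisym)
  show "onorm f \<le> (MAX p. \<bar>d p\<bar>)"
    by (intro onorm_le norm_symmetric_diagonal_le[OF assms] Max_ge) auto
  have lin: "linear f" and diag: "\<And>p. f (P p) = d p *\<^sub>R P p"
    using assms by (auto simp: symmetric_diagonal_def)
  have "\<bar>d p\<bar> \<le> onorm f" for p
    using onorm[OF linear_conv_bounded_linear[THEN iffD1, OF lin], of "P p"] basis_nonzero[OF assms(1), of p]
    by (simp add: diag)
  then show "(MAX p. \<bar>d p\<bar>) \<le> onorm f" by (subst Max_le_iff) auto
qed

lemma symmetric_diagonal_matrix:
  assumes "transpose A = A" "\<And>p. A *v P p = d p *\<^sub>R P p"
  shows "symmetric_diagonal P d ((*v) (A :: real^'n^'n))"
proof -
  have "(A *v x) \<bullet> y = x \<bullet> (A *v y)" for x y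
    using dot_lmul_matrix[of x A y] transpose_matrix_vector[of A x] assms(1) by simp
  then show ?thesis using assms(2) by (auto simp: symmetric_diagonal_def)
qed

section \<open>The recursion of the constants \<open>\<theta>\<close>\<close>

definition chains :: "nat \<Rightarrow> nat list set" where
  "chains k = {js. sorted_wrt (<) js \<and> set js \<subseteq> {..<k}}"

text \<open>
  On nonempty lists this is the summand of the inner sum of \<^const>\<open>theta_nat\<close>. The value at the
  empty list is the term that stands outside that sum, so that \<^const>\<open>theta_nat\<close> becomes a single
  sum over \<open>chains\<close>.
\<close>

definition chain_weight :: "(nat \<Rightarrow> 'a::real_normed_vector \<Rightarrow> 'a) \<Rightarrow> nat \<Rightarrow> nat list \<Rightarrow> real" where
  "chain_weight W k js = (if js = [] then onorm (compose_range W 0 k) else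
     onorm (compose_range W (last js + 1) k) *
     (\<Prod>i=1..<length js. onorm (compose_range W (js ! (i - 1) + 1) (js ! i))) *
     onorm (compose_range W 0 (js ! 0)))"

text \<open>
  The last index \<open>j\<close> of a chain carries the outermost norm. The other factors are exactly the weight
  of the shortened chain with \<open>j\<close> in the role of \<open>k\<close>; this is the source of the recursion below.
\<close>

lemma chain_weight_snoc:
  "chain_weight W k (js @ [j]) = onorm (compose_range W (j + 1) k) * chain_weight W j js"
proof (cases "js = []")
  case False
  then obtain n where n: "length js = Suc n" by (cases js) auto
  have "(\<Prod>i=1..<Suc n. onorm (compose_range W ((js @ [j]) ! (i - 1) + 1) ((js @ [j]) ! i)))
      = (\<Prod>i=1..<Suc n. onorm (compose_range W (js ! (i - 1) + 1) (js ! i)))"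
    by (rule prod.cong) (auto simp: nth_append n)
  then show ?thesis
    using False n by (simp add: chain_weight_def nth_append last_conv_nth mult_ac)
qed (simp add: chain_weight_def)

lemma length_chain_le: "js \<in> chains k \<Longrightarrow> length js \<le> k"
proof -
  assume "js \<in> chains k"
  then have "distinct js" "set js \<subseteq> {..<k}" by (auto simp: chains_def strict_sorted_iff)
  then show ?thesis using card_mono[of "{..<k}" "set js"] by (simp add: distinct_card)
qed

lemma finite_chains: "finite (chains k)"
  by (rule finite_subset[OF _ finite_lists_length_le[of "{..<k}" k]])
     (use length_chain_le in \<open>auto simp: chains_def\<close>)

lemma chains_split_last: "chains k = insert [] (\<Union>j<k. (\<lambda>js. js @ [j]) ` chains j)"
proof (intro equalityI subsetI)
  fix js assume js: "js \<in> chains k"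
  show "js \<in> insert [] (\<Union>j<k. (\<lambda>js. js @ [j]) ` chains j)"
  proof (cases js rule: rev_cases)
    case (snoc ks j)
    then show ?thesis using js by (auto simp: chains_def sorted_wrt_append)
  qed simp
next
  fix js assume "js \<in> insert [] (\<Union>j<k. (\<lambda>js. js @ [j]) ` chains j)"
  then show "js \<in> chains k" by (fastforce simp: chains_def sorted_wrt_append)
qed

lemma sum_chains_split_last:
  "(\<Sum>js\<in>chains k. f js) = f [] + (\<Sum>j<k. \<Sum>js\<in>chains j. f (js @ [j]))"
proof -
  have "(\<Sum>js\<in>chains k. f js) = f [] + (\<Sum>js\<in>(\<Union>j<k. (\<lambda>js. js @ [j]) ` chains j). f js)"
    by (subst chains_split_last, subst sum.insert) (auto simp: finite_chains)
  also have "(\<Sum>js\<in>(\<Union>j<k. (\<lambda>js. js @ [j]) ` chains j). f js)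
      = (\<Sum>j<k. \<Sum>js\<in>(\<lambda>js. js @ [j]) ` chains j. f js)"
    by (rule sum.UNION_disjoint) (auto simp: finite_chains)
  also have "\<dots> = (\<Sum>j<k. \<Sum>js\<in>chains j. f (js @ [j]))"
    by (rule sum.cong) (simp_all add: sum.reindex inj_on_def)
  finally show ?thesis .
qed

lemma theta_nat_eq_sum_chains: "theta_nat W k = (\<Sum>js\<in>chains k. chain_weight W k js)"
proof -
  let ?L = "\<lambda>m. {js. length js = Suc m \<and> sorted_wrt (<) js \<and> set js \<subseteq> {..<k}}"
  have L: "?L m = {js \<in> chains k. length js = Suc m}" for m by (auto simp: chains_def)
  have "chains k = insert [] (\<Union>m<k. ?L m)"
  proof (intro equalityI subsetI)
    fix js assume "js \<in> chains k"
    then show "js \<in> insert [] (\<Union>m<k. ?L m)"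
      using length_chain_le[of js k] by (cases js) (auto simp: L)
  qed (auto simp: chains_def)
  then have "(\<Sum>js\<in>chains k. chain_weight W k js) = (\<Sum>js\<in>insert [] (\<Union>m<k. ?L m). chain_weight W k js)"
    by simp
  also have "\<dots> = chain_weight W k [] + (\<Sum>js\<in>(\<Union>m<k. ?L m). chain_weight W k js)"
    by (subst sum.insert) (auto simp: L finite_chains)
  also have "(\<Sum>js\<in>(\<Union>m<k. ?L m). chain_weight W k js) = (\<Sum>m<k. \<Sum>js\<in>?L m. chain_weight W k js)"
    by (rule sum.UNION_disjoint) (auto simp: L finite_chains)
  also have "chain_weight W k [] + \<dots> = theta_nat W k"
    unfolding theta_nat_def
    by (intro arg_cong2[where f = "(+)"] sum.cong refl)
       (auto simp: chain_weight_def last_conv_nth atLeastLessThanSuc_atLeastAtMost)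
  finally show ?thesis by simp
qed

text \<open>
  Group the chains by their last index. This is the form in which the constants bound the errors
  of the layers, and the one from which their expression by eigenvalues is read off.
\<close>

lemma theta_nat_rec:
  "theta_nat W k = onorm (compose_range W 0 k) +
     (\<Sum>j<k. theta_nat W j * onorm (compose_range W (Suc j) k))"
proof -
  have "theta_nat W k = chain_weight W k [] + (\<Sum>j<k. \<Sum>js\<in>chains j. chain_weight W k (js @ [j]))"
    unfolding theta_nat_eq_sum_chains by (rule sum_chains_split_last)
  also have "chain_weight W k [] = onorm (compose_range W 0 k)"
    by (simp add: chain_weight_def)
  finally show ?thesis
    by (simp add: chain_weight_snoc theta_nat_eq_sum_chains sum_distrib_right mult.commute)
qed

section \<open>Convex lower semicontinuous functions\<close>

text \<open>
  Real thresholds suffice because the reals are dense in the extended reals, and the filter of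
  punctured neighbourhoods suffices because the inequality at the point itself is given.
\<close>

lemma lower_semicontinuous_iff_open:
  fixes f :: "'a::topological_space \<Rightarrow> ereal"
  shows "lower_semicontinuous f \<longleftrightarrow> (\<forall>z::real. open {u. ereal z < f u})"
proof
  assume lsc: "lower_semicontinuous f"
  show "\<forall>z::real. open {u. ereal z < f u}"
  proof
    fix z :: real
    show "open {u. ereal z < f u}"
    proof (subst open_subopen, intro ballI)
      fix x assume "x \<in> {u. ereal z < f u}"
      then have "ereal z < f x" by simp
      then have "eventually (\<lambda>v. ereal z < f v) (at x)"
        using lsc by (auto simp: lower_semicontinuous_def le_Liminf_iff)
      then obtain S where "open S" "x \<in> S" "\<forall>v\<in>S. v \<noteq> x \<longrightarrow> ereal z < f v"
        by (auto simp: eventually_at_topological)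
      then show "\<exists>S. open S \<and> x \<in> S \<and> S \<subseteq> {u. ereal z < f u}"
        using \<open>ereal z < f x\<close> by (intro exI[of _ S]) auto
    qed
  qed
next
  assume op: "\<forall>z::real. open {u. ereal z < f u}"
  show "lower_semicontinuous f"
    unfolding lower_semicontinuous_def le_Liminf_iff
  proof (intro allI impI)
    fix x y assume "y < f x"
    then obtain z where z: "y < ereal z" "ereal z < f x" using ereal_dense2 by blast
    then have "open {u. ereal z < f u}" "x \<in> {u. ereal z < f u}" using op by auto
    then show "eventually (\<lambda>v. y < f v) (at x)"
      using z(1) unfolding eventually_at_topological
      by (intro exI[of _ "{u. ereal z < f u}"]) auto
  qed
qed

lemma lower_semicontinuous_ereal:
  fixes h :: "'a::topological_space \<Rightarrow> real"
  assumes "continuous_on UNIV h"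
  shows "lower_semicontinuous (\<lambda>x. ereal (h x))"
  by (auto simp: lower_semicontinuous_iff_open intro!: open_Collect_less assms continuous_on_const)

lemma lower_semicontinuous_scale:
  fixes f :: "'a::topological_space \<Rightarrow> ereal"
  assumes "lower_semicontinuous f" "t > 0"
  shows "lower_semicontinuous (\<lambda>x. ereal t * f x)"
proof -
  have "ereal z < ereal t * f x \<longleftrightarrow> ereal (z / t) < f x" for z x
    using assms(2) by (cases "f x") (auto simp: field_simps)
  then show ?thesis using assms(1) by (simp add: lower_semicontinuous_iff_open)
qed

text \<open>
  Where neither summand is \<open>-\<infinity>\<close>, a strict lower bound \<open>z\<close> of the sum can be shared out as
  \<open>w + (z - w)\<close> between the summands. Hence the superlevel sets of the sum are unions of
  intersections of superlevel sets.
\<close>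

lemma lower_semicontinuous_add:
  fixes f g :: "'a::topological_space \<Rightarrow> ereal"
  assumes "lower_semicontinuous f" "lower_semicontinuous g"
    and "\<And>x. f x \<noteq> -\<infinity>" "\<And>x. g x \<noteq> -\<infinity>"
  shows "lower_semicontinuous (\<lambda>x. f x + g x)"
  unfolding lower_semicontinuous_iff_open
proof
  fix z :: real
  have split: "\<exists>w. ereal w < f x \<and> ereal (z - w) < g x" if "ereal z < f x + g x" for x
  proof (cases "f x" "g x" rule: ereal2_cases)
    case (real_real a b)
    then show ?thesis using that by (intro exI[of _ "a - (a + b - z) / 2"]) (auto simp: field_simps)
  next
    case (real_PInf a)
    then show ?thesis by (intro exI[of _ "a - 1"]) auto
  next
    case (PInf_real b)
    then show ?thesis by (intro exI[of _ "z - b + 1"]) auto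
  qed (use assms(3,4)[of x] in auto)
  have join: "ereal z < f x + g x" if "ereal w < f x" "ereal (z - w) < g x" for x w
    using that by (cases "f x" "g x" rule: ereal2_cases) auto
  have "{x. ereal z < f x + g x} = (\<Union>w. {x. ereal w < f x} \<inter> {x. ereal (z - w) < g x})"
    using split join by blast
  moreover have "open (\<Union>w. {x. ereal w < f x} \<inter> {x. ereal (z - w) < g x})"
    using assms(1,2) unfolding lower_semicontinuous_iff_open
    by (intro open_UN open_Int ballI) blast+
  ultimately show "open {x. ereal z < f x + g x}" by simp
qed

lemma convex_fun_add:
  fixes f g :: "'a::real_vector \<Rightarrow> ereal"
  assumes "convex_fun f" "convex_fun g" "\<And>x. f x \<noteq> -\<infinity>" "\<And>x. g x \<noteq> -\<infinity>"
  shows "convex_fun (\<lambda>x. f x + g x)"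
  unfolding convex_fun_def
proof (intro allI impI)
  fix x y :: 'a and t :: real assume t: "0 < t \<and> t < 1"
  let ?z = "(1 - t) *\<^sub>R x + t *\<^sub>R y"
  have "f ?z + g ?z \<le> (ereal (1 - t) * f x + ereal t * f y) + (ereal (1 - t) * g x + ereal t * g y)"
    using assms(1,2) t by (intro add_mono) (auto simp: convex_fun_def)
  also have "\<dots> = ereal (1 - t) * (f x + g x) + ereal t * (f y + g y)"
    using t assms(3)[of x] assms(3)[of y] assms(4)[of x] assms(4)[of y]
    by (cases "f x"; cases "f y"; cases "g x"; cases "g y") (auto simp: algebra_simps)
  finally show "f ?z + g ?z \<le> ereal (1 - t) * (f x + g x) + ereal t * (f y + g y)" .
qed

lemma sum_convex_lower_semicontinuous:
  fixes f :: "'i \<Rightarrow> 'a::real_normed_vector \<Rightarrow> ereal"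
  assumes "\<And>i. i \<in> I \<Longrightarrow> convex_fun (f i) \<and> lower_semicontinuous (f i) \<and> (\<forall>x. f i x \<noteq> -\<infinity>)"
  shows "convex_fun (\<lambda>x. \<Sum>i\<in>I. f i x) \<and> lower_semicontinuous (\<lambda>x. \<Sum>i\<in>I. f i x)
    \<and> (\<forall>x. (\<Sum>i\<in>I. f i x) \<noteq> -\<infinity>)"
  using assms
proof (induction I rule: infinite_finite_induct)
  case (insert i I)
  have "convex_fun (f i)" "lower_semicontinuous (f i)" "\<And>x. f i x \<noteq> -\<infinity>"
    "convex_fun (\<lambda>x. \<Sum>i\<in>I. f i x)" "lower_semicontinuous (\<lambda>x. \<Sum>i\<in>I. f i x)"
    "\<And>x. (\<Sum>i\<in>I. f i x) \<noteq> -\<infinity>"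
    using insert by auto
  then show ?case
    using insert.hyps by (auto intro!: convex_fun_add lower_semicontinuous_add)
qed (auto simp: convex_fun_def lower_semicontinuous_iff_open zero_ereal_def)

text \<open>
  If the minimum is not attained, every point of \<open>S\<close> lies in \<open>{x. f y < f x}\<close> for some \<open>y \<in> S\<close>.
  Finitely many of these open sets cover \<open>S\<close>, but the lowest of the corresponding \<open>y\<close> is in
  none of them.
\<close>

lemma lower_semicontinuous_attains_min:
  fixes f :: "'a::topological_space \<Rightarrow> ereal"
  assumes "lower_semicontinuous f" "\<And>x. f x \<noteq> -\<infinity>" "compact S" "S \<noteq> {}"
  obtains x where "x \<in> S" "\<And>y. y \<in> S \<Longrightarrow> f x \<le> f y"
proof (rule ccontr)
  assume "\<not> thesis"
  then have worse: "\<exists>y\<in>S. f y < f x" if "x \<in> S" for x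
    using that \<open>\<And>x. x \<in> S \<Longrightarrow> (\<And>y. y \<in> S \<Longrightarrow> f x \<le> f y) \<Longrightarrow> thesis\<close> by (meson not_le)
  have "open {x. f y < f x}" for y
    using assms(1) assms(2)[of y]
    by (cases "f y") (auto simp: lower_semicontinuous_iff_open)
  moreover have "S \<subseteq> (\<Union>y\<in>S. {x. f y < f x})" using worse by fast
  ultimately obtain F where F: "F \<subseteq> S" "finite F" "S \<subseteq> (\<Union>y\<in>F. {x. f y < f x})"
    by (rule compactE_image[OF assms(3), of S "\<lambda>y. {x. f y < f x}"])
  then have "F \<noteq> {}" using assms(4) by auto
  then have "Min (f ` F) \<in> f ` F" using F(2) by simp
  then obtain y where y: "y \<in> F" "f y = Min (f ` F)" by (metis imageE)
  then have "y \<in> (\<Union>y\<in>F. {x. f y < f x})" using F(1,3) by (meson subsetD)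
  then obtain y' where "y' \<in> F" "f y' < f y" by auto
  then show False using Min_le[of "f ` F" "f y'"] F(2) y(2) by (auto simp: not_le[symmetric])
qed

section \<open>The proximity operator\<close>

text \<open>
  The function attains a minimum \<open>m\<close> on the unit ball around \<open>x\<^sub>0\<close>. A segment from \<open>x\<^sub>0\<close> to a point
  outside this ball meets the unit sphere, where the value is at least \<open>m\<close>, and convexity
  along the segment then bounds the value at the far end.
\<close>

lemma Gamma0_linear_lower_bound:
  fixes g :: "'a::euclidean_space \<Rightarrow> ereal"
  assumes "g \<in> Gamma0" "g x\<^sub>0 = ereal a"
  obtains B where "B \<ge> 0" "\<And>u. ereal (a - B * (1 + norm (u - x\<^sub>0))) \<le> g u"
proof -
  have cvx: "convex_fun g" and lsc: "lower_semicontinuous g" and ninf: "\<And>x. g x \<noteq> -\<infinity>"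
    using assms(1) by (auto simp: Gamma0_def proper_fun_def)
  obtain x\<^sub>1 where x1: "x\<^sub>1 \<in> cball x\<^sub>0 1" "\<And>u. u \<in> cball x\<^sub>0 1 \<Longrightarrow> g x\<^sub>1 \<le> g u"
    using lower_semicontinuous_attains_min[OF lsc ninf compact_cball, of x\<^sub>0 1] by auto
  have "g x\<^sub>1 \<le> ereal a" using x1(2)[of x\<^sub>0] assms(2) by simp
  then obtain m where m: "g x\<^sub>1 = ereal m" using ninf[of x\<^sub>1] by (cases "g x\<^sub>1") auto
  then have "m \<le> a" using \<open>g x\<^sub>1 \<le> ereal a\<close> by simp
  show ?thesis
  proof (rule that[of "a - m"])
    show "0 \<le> a - m" using \<open>m \<le> a\<close> by simp
    fix u
    let ?n = "norm (u - x\<^sub>0)"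
    have pos: "0 \<le> (a - m) * ?n" using \<open>m \<le> a\<close> by simp
    show "ereal (a - (a - m) * (1 + ?n)) \<le> g u"
    proof (cases "?n \<le> 1")
      case True
      then have "ereal m \<le> g u" using x1(2)[of u] m by (simp add: dist_norm norm_minus_commute)
      moreover have "a - (a - m) * (1 + ?n) \<le> m" using pos by (simp add: algebra_simps)
      ultimately show ?thesis by (meson ereal_less_eq(3) order_trans)
    next
      case False
      \<comment> \<open>the parameter at which the segment from \<open>x\<^sub>0\<close> to \<open>u\<close> crosses the unit sphere\<close>
      define s where "s = 1 / ?n"
      have "?n > 1" using False by simp
      then have s: "0 < s" "s < 1" "s * ?n = 1" unfolding s_def
        by (simp_all only: zero_less_divide_1_iff divide_less_eq_1 nonzero_divide_eq_eq) auto
      have "(1 - s) *\<^sub>R x\<^sub>0 + s *\<^sub>R u = x\<^sub>0 + s *\<^sub>R (u - x\<^sub>0)" by (simp add: algebra_simps)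
      moreover have "x\<^sub>0 + s *\<^sub>R (u - x\<^sub>0) \<in> cball x\<^sub>0 1" using s by (simp add: dist_norm)
      ultimately have "ereal m \<le> g ((1 - s) *\<^sub>R x\<^sub>0 + s *\<^sub>R u)" using x1(2) m by metis
      also have "\<dots> \<le> ereal (1 - s) * ereal a + ereal s * g u"
        using cvx s assms(2) by (metis convex_fun_def)
      finally have le: "ereal m \<le> ereal (1 - s) * ereal a + ereal s * g u" .
      show ?thesis
      proof (cases "g u")
        case (real b)
        then have "m \<le> (1 - s) * a + s * b" using le by simp
        then have "m * ?n \<le> ((1 - s) * a + s * b) * ?n" by (rule mult_right_mono) simp
        also have "\<dots> = a * ?n - a * (s * ?n) + b * (s * ?n)" by (simp add: algebra_simps)
        finally have "a - (a - m) * ?n \<le> b" unfolding s(3) by (simp add: algebra_simps)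
        then show ?thesis using \<open>m \<le> a\<close> real by (simp add: algebra_simps)
      qed (use ninf in auto)
    qed
  qed
qed

definition prox_objective :: "real \<Rightarrow> ('a::real_normed_vector \<Rightarrow> ereal) \<Rightarrow> 'a \<Rightarrow> 'a \<Rightarrow> ereal" where
  "prox_objective t g x u = ereal (1/2 * (norm (x - u))\<^sup>2) + ereal t * g u"

text \<open>
  The quadratic term dominates the at most linear decrease of \<open>t * g\<close>. So outside of a large ball
  around a point \<open>x\<^sub>0\<close> of the domain the objective is at least its value at \<open>x\<^sub>0\<close>, and inside the
  ball compactness applies.
\<close>

lemma prox_objective_attains_min:
  fixes g :: "'a::euclidean_space \<Rightarrow> ereal"
  assumes "g \<in> Gamma0" "t > 0"
  obtains u where "\<And>w. prox_objective t g x u \<le> prox_objective t g x w"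
proof -
  have lsc: "lower_semicontinuous g" and ninf: "\<And>x. g x \<noteq> -\<infinity>" and "\<exists>x. g x \<noteq> \<infinity>"
    using assms(1) by (auto simp: Gamma0_def proper_fun_def)
  then obtain x\<^sub>0 a where x0: "g x\<^sub>0 = ereal a" by (metis ereal_cases)
  obtain B where B: "B \<ge> 0" "\<And>u. ereal (a - B * (1 + norm (u - x\<^sub>0))) \<le> g u"
    using Gamma0_linear_lower_bound[OF assms(1) x0] by blast
  let ?\<phi> = "prox_objective t g x"
  have "lower_semicontinuous ?\<phi>"
    unfolding prox_objective_def using assms(2) ninf
    by (intro lower_semicontinuous_add lower_semicontinuous_ereal lower_semicontinuous_scale lsc
        continuous_intros) auto
  moreover have "?\<phi> u \<noteq> -\<infinity>" for u
    using ninf[of u] assms(2) by (cases "g u") (auto simp: prox_objective_def)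
  moreover define d where "d = norm (x - x\<^sub>0)"
  \<comment> \<open>At a distance \<open>n > \<rho>\<close> from \<open>x\<^sub>0\<close> both \<open>n \<ge> 1\<close> and \<open>n / 2 - d - t * B \<ge> t * B\<close> hold, so \<open>n\<^sup>2 / 2 - d * n\<close>
    is at least \<open>t * B * (1 + n)\<close>.\<close>
  define \<rho> where "\<rho> = 2 * d + 4 * (t * B) + 1"
  have "d \<ge> 0" "t * B \<ge> 0" using assms(2) B(1) by (auto simp: d_def)
  then have "\<rho> \<ge> 0" by (simp add: \<rho>_def)
  ultimately obtain u where u: "\<And>w. w \<in> cball x\<^sub>0 \<rho> \<Longrightarrow> ?\<phi> u \<le> ?\<phi> w"
    using lower_semicontinuous_attains_min[of ?\<phi> "cball x\<^sub>0 \<rho>"]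
    by (metis compact_cball cball_eq_empty not_less)
  have outside: "?\<phi> x\<^sub>0 \<le> ?\<phi> w" if "w \<notin> cball x\<^sub>0 \<rho>" for w
  proof -
    define n where "n = norm (w - x\<^sub>0)"
    have n: "n > \<rho>" using that by (simp add: n_def dist_norm norm_minus_commute)
    have "(x - x\<^sub>0) \<bullet> (w - x\<^sub>0) \<le> d * n" unfolding d_def n_def by (rule norm_cauchy_schwarz)
    moreover have "(norm (x - w))\<^sup>2 = d\<^sup>2 - 2 * ((x - x\<^sub>0) \<bullet> (w - x\<^sub>0)) + n\<^sup>2"
      unfolding d_def n_def power2_norm_eq_inner by (simp add: algebra_simps inner_commute)
    ultimately have quad: "d\<^sup>2 - 2 * (d * n) + n\<^sup>2 \<le> (norm (x - w))\<^sup>2" by linarith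
    have "t * B \<le> 1 * (n / 2 - d - t * B)" using n \<open>d \<ge> 0\<close> \<open>t * B \<ge> 0\<close> by (simp add: \<rho>_def field_simps)
    also have "\<dots> \<le> n * (n / 2 - d - t * B)"
      using n \<open>d \<ge> 0\<close> \<open>t * B \<ge> 0\<close> by (intro mult_right_mono) (auto simp: \<rho>_def)
    finally have "d\<^sup>2 / 2 + t * a \<le> (d\<^sup>2 - 2 * (d * n) + n\<^sup>2) / 2 + t * (a - B * (1 + n))"
      by (simp add: algebra_simps power2_eq_square)
    then have "d\<^sup>2 / 2 + t * a \<le> (norm (x - w))\<^sup>2 / 2 + t * (a - B * (1 + n))"
      by (rule order_trans) (use quad in simp)
    then have "?\<phi> x\<^sub>0 \<le> ereal (1/2 * (norm (x - w))\<^sup>2) + ereal t * ereal (a - B * (1 + n))"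
      by (simp add: prox_objective_def x0 d_def)
    also have "\<dots> \<le> ?\<phi> w"
      unfolding prox_objective_def n_def using assms(2) B(2)[of w]
      by (intro add_left_mono ereal_mult_left_mono) auto
    finally show ?thesis .
  qed
  have "?\<phi> u \<le> ?\<phi> x\<^sub>0" using u[of x\<^sub>0] \<open>\<rho> \<ge> 0\<close> by simp
  then have "?\<phi> u \<le> ?\<phi> w" for w using u[of w] outside[of w] by (meson order_trans)
  then show ?thesis by (rule that)
qed

lemma prox_objective_min_finite:
  fixes g :: "'a::euclidean_space \<Rightarrow> ereal"
  assumes "g \<in> Gamma0" "t > 0" "\<And>w. prox_objective t g x u \<le> prox_objective t g x w"
  obtains a where "g u = ereal a"
proof -
  have "g u \<noteq> -\<infinity>" and "\<exists>x. g x \<noteq> \<infinity> \<and> g x \<noteq> -\<infinity>"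
    using assms(1) by (auto simp: Gamma0_def proper_fun_def)
  then obtain x\<^sub>0 b where x0: "g x\<^sub>0 = ereal b" by (metis ereal_cases)
  then show ?thesis
    using assms(3)[of x\<^sub>0] assms(2) \<open>g u \<noteq> -\<infinity>\<close>
    by (cases "g u") (auto simp: prox_objective_def intro: that)
qed

lemma norm_diff_scaleR_power2:
  fixes v w :: "'a::real_inner"
  shows "(norm (v - s *\<^sub>R w))\<^sup>2 = (norm v)\<^sup>2 - 2 * (s * (v \<bullet> w)) + s\<^sup>2 * (norm w)\<^sup>2"
  using dot_norm_neg[of v "s *\<^sub>R w"] by (simp add: power_mult_distrib field_simps)

text \<open>
  Compare the minimizer \<open>u\<close> with the points \<open>(1 - s) u + s w\<close>, bound \<open>g\<close> there by convexity, divide by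
  \<open>s\<close> and let \<open>s\<close> tend to \<open>0\<close>.
\<close>

lemma prox_objective_min_variational:
  fixes g :: "'a::euclidean_space \<Rightarrow> ereal"
  assumes "convex_fun g" "t > 0" "\<And>w. prox_objective t g x u \<le> prox_objective t g x w"
    and "g u = ereal a" "g w = ereal b"
  shows "(x - u) \<bullet> (w - u) \<le> t * (b - a)"
proof -
  let ?N = "(norm (w - u))\<^sup>2"
  have bound: "(x - u) \<bullet> (w - u) \<le> s * ?N / 2 + t * (b - a)" if s: "0 < s" "s < 1" for s
  proof -
    let ?v = "(1 - s) *\<^sub>R u + s *\<^sub>R w"
    have "g ?v \<le> ereal ((1 - s) * a + s * b)"
      using assms(1)[unfolded convex_fun_def, rule_format, of s u w] assms(4,5) s by simp
    then have "prox_objective t g x ?v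
        \<le> ereal (1/2 * (norm (x - ?v))\<^sup>2) + ereal t * ereal ((1 - s) * a + s * b)"
      unfolding prox_objective_def using assms(2)
      by (intro add_left_mono ereal_mult_left_mono) auto
    with assms(3)[of ?v] have "prox_objective t g x u
        \<le> ereal (1/2 * (norm (x - ?v))\<^sup>2) + ereal t * ereal ((1 - s) * a + s * b)"
      by (rule order_trans)
    then have "(norm (x - u))\<^sup>2 / 2 + t * a \<le> (norm (x - ?v))\<^sup>2 / 2 + t * ((1 - s) * a + s * b)"
      by (simp add: prox_objective_def assms(4))
    moreover have "x - ?v = (x - u) - s *\<^sub>R (w - u)" by (simp add: algebra_simps)
    then have "(norm (x - ?v))\<^sup>2 = (norm (x - u))\<^sup>2 - 2 * (s * ((x - u) \<bullet> (w - u))) + s\<^sup>2 * ?N"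
      by (simp only: norm_diff_scaleR_power2)
    moreover have "s\<^sup>2 * ?N / 2 + t * ((1 - s) * a + s * b) - t * a = s * (s * ?N / 2 + t * (b - a))"
      by (simp add: algebra_simps power2_eq_square)
    ultimately have "s * ((x - u) \<bullet> (w - u)) \<le> s * (s * ?N / 2 + t * (b - a))"
      by linarith
    then show ?thesis using s(1) by (simp add: mult_le_cancel_left_pos)
  qed
  have "((\<lambda>s. s * ?N / 2 + t * (b - a)) \<longlongrightarrow> 0 * ?N / 2 + t * (b - a)) (at_right 0)"
    by (intro tendsto_intros) auto
  moreover have "eventually (\<lambda>s. (x - u) \<bullet> (w - u) \<le> s * ?N / 2 + t * (b - a)) (at_right 0)"
    using eventually_at_right_real[OF zero_less_one] by eventually_elim (use bound in auto)
  ultimately show ?thesis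
    using tendsto_lowerbound[of "\<lambda>s. s * ?N / 2 + t * (b - a)" _ "at_right (0::real)"] by fastforce
qed

text \<open>
  Add the variational inequality of \<open>u\<close> tested at \<open>v\<close> to that of \<open>v\<close> tested at \<open>u\<close>: the values of
  \<open>g\<close> cancel. For \<open>x = y\<close> this is the uniqueness of the minimizer.
\<close>

lemma prox_objective_min_firm:
  fixes g :: "'a::euclidean_space \<Rightarrow> ereal"
  assumes "g \<in> Gamma0" "t > 0"
    and "\<And>w. prox_objective t g x u \<le> prox_objective t g x w"
    and "\<And>w. prox_objective t g y v \<le> prox_objective t g y w"
  shows "(norm (u - v))\<^sup>2 \<le> (x - y) \<bullet> (u - v)"
proof -
  have cvx: "convex_fun g" using assms(1) by (simp add: Gamma0_def)
  obtain a where a: "g u = ereal a" using prox_objective_min_finite[OF assms(1,2,3)] .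
  obtain b where b: "g v = ereal b" using prox_objective_min_finite[OF assms(1,2,4)] .
  have "(x - u) \<bullet> (v - u) + (y - v) \<bullet> (u - v) \<le> t * (b - a) + t * (a - b)"
    by (intro add_mono prox_objective_min_variational[OF cvx assms(2)] assms(3,4) a b)
  then show ?thesis
    by (simp add: power2_norm_eq_inner inner_diff_left inner_diff_right inner_commute algebra_simps)
qed

lemma prox_is_min:
  fixes g :: "'a::euclidean_space \<Rightarrow> ereal"
  assumes "g \<in> Gamma0" "t > 0"
  shows "prox_objective t g x (prox t g x) \<le> prox_objective t g x w"
proof -
  let ?min = "\<lambda>u. \<forall>w. prox_objective t g x u \<le> prox_objective t g x w"
  obtain u where "?min u" using prox_objective_attains_min[OF assms] by metis
  moreover have "v = u'" if "?min v" "?min u'" for v u'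
    using prox_objective_min_firm[OF assms, of x v x u'] that by simp
  ultimately have "\<exists>!u. ?min u" by blast
  moreover have "prox t g x = (THE u. ?min u)"
    by (simp add: prox_def is_arg_min_def prox_objective_def not_less)
  ultimately have "?min (prox t g x)" using theI'[of ?min] by simp
  then show ?thesis by blast
qed

text \<open>
  Firm nonexpansiveness says that the reflection \<open>2 * prox t g x - x\<close> is nonexpansive in \<open>x\<close>, and the
  proximity operator is the midpoint of this reflection and the identity.
\<close>

lemma prox_averaged:
  fixes g :: "'a::euclidean_space \<Rightarrow> ereal"
  assumes "g \<in> Gamma0" "t > 0"
  shows "averaged (1/2) (prox t g)"
proof -
  let ?p = "prox t g"
  have "norm ((2 *\<^sub>R ?p x - x) - (2 *\<^sub>R ?p y - y)) \<le> norm (x - y)" for x y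
  proof (rule power2_le_imp_le)
    let ?u = "?p x - ?p y"
    have eq: "(2 *\<^sub>R ?p x - x) - (2 *\<^sub>R ?p y - y) = 2 *\<^sub>R ?u - (x - y)"
      by (simp add: algebra_simps)
    have "(norm (2 *\<^sub>R ?u - (x - y)))\<^sup>2 = 4 * (norm ?u)\<^sup>2 - 4 * ((x - y) \<bullet> ?u) + (norm (x - y))\<^sup>2"
      using dot_norm_neg[of "2 *\<^sub>R ?u" "x - y"] by (simp add: power_mult_distrib inner_commute)
    also have "\<dots> \<le> (norm (x - y))\<^sup>2"
      using prox_objective_min_firm[OF assms prox_is_min[OF assms] prox_is_min[OF assms], of x y]
      by simp
    finally show "(norm ((2 *\<^sub>R ?p x - x) - (2 *\<^sub>R ?p y - y)))\<^sup>2 \<le> (norm (x - y))\<^sup>2"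
      by (simp only: eq)
  qed simp
  then have "nonexpansive (\<lambda>x. 2 *\<^sub>R ?p x - x)"
    by (auto simp: nonexpansive_def dist_norm intro!: lipschitz_onI)
  then show ?thesis
    unfolding averaged_def
    by (intro conjI exI[of _ "\<lambda>x. 2 *\<^sub>R ?p x - x"]) (auto simp: algebra_simps)
qed

section \<open>The logarithmic barrier\<close>

text \<open>
  The barrier is the sum of these terms over the constraints, infinite values included, so that its
  convexity and semicontinuity reduce to those of a single constraint.
\<close>

definition log_term :: "('a \<Rightarrow> ereal) \<Rightarrow> 'a \<Rightarrow> ereal" where
  "log_term c x = (if c x > 0 then ereal (- ln (real_of_ereal (c x))) else \<infinity>)"

lemma log_barrier_eq_sum: "log_barrier r c x = (\<Sum>i=1..r. log_term (c i) x)"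
proof (cases "x \<in> strict_interior r c")
  case True
  then have "(\<Sum>i=1..r. log_term (c i) x) = (\<Sum>i=1..r. ereal (- ln (real_of_ereal (c i x))))"
    by (intro sum.cong) (auto simp: strict_interior_def log_term_def)
  then show ?thesis using True by (simp add: log_barrier_def sum_negf)
next
  case False
  then have "\<exists>i\<in>{1..r}. log_term (c i) x = \<infinity>"
    by (auto simp: strict_interior_def log_term_def)
  then have "(\<Sum>i=1..r. log_term (c i) x) = \<infinity>" by (subst sum_Pinfty) auto
  then show ?thesis using False by (simp add: log_barrier_def)
qed

text \<open>
  Concavity of \<open>c\<close> gives \<open>c ((1 - t) x + t y) \<ge> (1 - t) c x + t c y\<close>; the logarithm is increasing
  and concave.
\<close>

lemma log_term_convex:
  assumes "convex_fun (\<lambda>x. - c x)" "\<And>x. c x \<noteq> \<infinity>"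
  shows "convex_fun (log_term c)"
  unfolding convex_fun_def
proof (intro allI impI)
  fix x y :: 'a and t :: real assume t: "0 < t \<and> t < 1"
  let ?z = "(1 - t) *\<^sub>R x + t *\<^sub>R y"
  show "log_term c ?z \<le> ereal (1 - t) * log_term c x + ereal t * log_term c y"
  proof (cases "c x > 0 \<and> c y > 0")
    case True
    then obtain a b where ab: "c x = ereal a" "c y = ereal b" "a > 0" "b > 0"
      using assms(2)[of x] assms(2)[of y] by (cases "c x"; cases "c y") auto
    let ?m = "(1 - t) * a + t * b"
    have "?m > 0" using t ab by (intro add_pos_pos mult_pos_pos) auto
    have "- c ?z \<le> ereal (1 - t) * (- c x) + ereal t * (- c y)"
      using assms(1) t unfolding convex_fun_def by blast
    then have "- c ?z \<le> ereal (- ?m)" by (simp add: ab algebra_simps)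
    then obtain e where e: "c ?z = ereal e" "?m \<le> e"
      using assms(2)[of ?z] by (cases "c ?z") auto
    have "(1 - t) * ln a + t * ln b \<le> ln ?m"
      using concave_onD[OF ln_concave, of t a b] t ab by simp
    also have "\<dots> \<le> ln e" using e \<open>?m > 0\<close> by simp
    finally show ?thesis using e \<open>?m > 0\<close> ab by (simp add: log_term_def algebra_simps)
  next
    case False
    have "log_term c v \<noteq> -\<infinity>" for v by (simp add: log_term_def)
    moreover have "log_term c x = \<infinity> \<or> log_term c y = \<infinity>" using False by (auto simp: log_term_def)
    ultimately have "ereal (1 - t) * log_term c x + ereal t * log_term c y = \<infinity>"
      using t by (cases "log_term c x"; cases "log_term c y") auto
    then show ?thesis by (metis ereal_less_eq(1))
  qed
qed

text \<open>
  The superlevel set of height \<open>z\<close> is that of \<open>- c\<close> of height \<open>- exp (- z)\<close>. This covers also the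
  points with \<open>c x \<le> 0\<close>, where the term is \<open>\<infinity>\<close>, since \<open>exp (- z) > 0\<close>.
\<close>

lemma log_term_lower_semicontinuous:
  assumes "lower_semicontinuous (\<lambda>x. - c x)" "\<And>x. c x \<noteq> \<infinity>"
  shows "lower_semicontinuous (log_term c)"
proof -
  have "ereal z < log_term c x \<longleftrightarrow> ereal (- exp (- z)) < - c x" for z x
  proof (cases "c x")
    case (real a)
    have "z < - ln a \<longleftrightarrow> a < exp (- z)" if "a > 0"
    proof -
      have "ln a < - z \<longleftrightarrow> a < exp (- z)" using that by (metis exp_less_cancel_iff exp_ln)
      then show ?thesis by linarith
    qed
    then show ?thesis using real
      by (auto simp: log_term_def not_less intro: le_less_trans[OF _ exp_gt_zero])
  qed (use assms(2) in \<open>auto simp: log_term_def\<close>)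
  then show ?thesis using assms(1) by (simp add: lower_semicontinuous_iff_open)
qed

lemma log_barrier_Gamma0:
  fixes c :: "nat \<Rightarrow> 'a::euclidean_space \<Rightarrow> ereal"
  assumes "\<And>i. i \<in> {1..r} \<Longrightarrow> (\<lambda>x. - c i x) \<in> Gamma0" "strict_interior r c \<noteq> {}"
  shows "log_barrier r c \<in> Gamma0"
proof -
  have "convex_fun (log_term (c i)) \<and> lower_semicontinuous (log_term (c i)) \<and> (\<forall>x. log_term (c i) x \<noteq> -\<infinity>)"
    if "i \<in> {1..r}" for i
  proof -
    have "c i x \<noteq> \<infinity>" for x
      using assms(1)[OF that] by (auto simp: Gamma0_def proper_fun_def)
    then show ?thesis
      using assms(1)[OF that] log_term_convex[of "c i"] log_term_lower_semicontinuous[of "c i"]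
      by (auto simp: Gamma0_def) (auto simp: log_term_def split: if_splits)
  qed
  from sum_convex_lower_semicontinuous[of "{1..r}" "\<lambda>i. log_term (c i)", OF this]
  have "convex_fun (log_barrier r c) \<and> lower_semicontinuous (log_barrier r c) \<and> (\<forall>x. log_barrier r c x \<noteq> -\<infinity>)"
    by (simp add: log_barrier_eq_sum[abs_def])
  moreover have "\<exists>x. log_barrier r c x \<noteq> \<infinity>"
    using assms(2) by (auto simp: log_barrier_def)
  ultimately show ?thesis by (auto simp: Gamma0_def proper_fun_def)
qed

section \<open>Averagedness of a composition of layers\<close>

text \<open>
  Here \<open>M\<close> stands for an upper bound of the norm of \<open>W - 2 ^ K (1 - \<alpha>) Id\<close> with \<open>K = m + 1\<close> layers.
  The linear part contributes \<open>M\<close>, the errors of the layers \<open>j < m\<close> contribute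
  \<open>theta_nat W m - onorm (compose_range W 0 m)\<close> by the recursion of \<^const>\<open>theta_nat\<close>, and the error of
  layer \<open>m\<close>, to which no further operator is applied, contributes \<open>theta_nat W m\<close>.
\<close>

lemma layers_averaged:
  fixes W :: "nat \<Rightarrow> 'a::euclidean_space \<Rightarrow> 'a"
  assumes lin: "\<And>k. k \<le> m \<Longrightarrow> linear (W k)"
    and av: "\<And>k. k \<le> m \<Longrightarrow> averaged (1/2) (R k)"
    and \<alpha>: "0 < \<alpha>" "\<alpha> \<le> 1"
    and dist: "\<And>x. norm (compose_range W 0 m x - (2 ^ Suc m * (1 - \<alpha>)) *\<^sub>R x) \<le> M * norm x"
    and bound: "M - onorm (compose_range W 0 m) + 2 * theta_nat W m \<le> 2 ^ Suc m * \<alpha>"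
  shows "averaged \<alpha> (compose_range (\<lambda>k. R k \<circ> (\<lambda>x. W k x + b k)) 0 m)"
proof -
  let ?T = "\<lambda>k. R k \<circ> (\<lambda>x. W k x + b k)"
  let ?C = "\<lambda>k. compose_range ?T 0 k"
  let ?c = "2 ^ Suc m * (1 - \<alpha>)"
  have "\<forall>k. \<exists>S. k \<le> m \<longrightarrow> nonexpansive S \<and> R k = (\<lambda>x. (1 - 1/2) *\<^sub>R x + (1/2) *\<^sub>R S x)"
    using av by (auto simp: averaged_def)
  then obtain S where S: "\<And>k. k \<le> m \<Longrightarrow> nonexpansive (S k)"
    "\<And>k. k \<le> m \<Longrightarrow> R k = (\<lambda>x. (1 - 1/2) *\<^sub>R x + (1/2) *\<^sub>R S k x)" by metis
  have estimate: "norm ((?C m x - ?C m y) - (1 - \<alpha>) *\<^sub>R (x - y)) \<le> \<alpha> * norm (x - y)" for x y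
  proof -
    define \<delta> where "\<delta> = x - y"
    \<comment> \<open>\<open>a k u\<close> is what \<open>R k\<close> receives when the input is \<open>u\<close>, \<open>v k\<close> is the difference of these
      vectors for the inputs \<open>x\<close> and \<open>y\<close>, and \<open>e k\<close> is the error of layer \<open>k\<close>. The powers of \<open>2\<close>
      absorb the factor \<open>1/2\<close> of every layer, so that the unrolled sum has no coefficients.\<close>
    define a where "a k u = (if k = 0 then W 0 u + b 0 else W k (?C (k - 1) u) + b k)" for k u
    define v where "v k = a k x - a k y" for k
    define e where "e k = (2 ^ k) *\<^sub>R (S k (a k x) - S k (a k y))" for k
    have a_Suc: "a (Suc k) u = W (Suc k) (?C k u) + b (Suc k)" for k u by (simp add: a_def)
    have C_eq: "?C k u = (1/2) *\<^sub>R (a k u + S k (a k u))" if "k \<le> m" for k u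
      by (cases k) (use that in \<open>auto simp: a_def compose_range_self compose_range_Suc S(2) scaleR_add_right\<close>)
    have out: "(2 ^ Suc k) *\<^sub>R (?C k x - ?C k y) = (2 ^ k) *\<^sub>R v k + e k" if "k \<le> m" for k
    proof -
      have "?C k x - ?C k y = (1/2) *\<^sub>R (v k + (S k (a k x) - S k (a k y)))"
        unfolding C_eq[OF that] v_def by (simp add: algebra_simps)
      then show ?thesis by (simp add: e_def scaleR_add_right)
    qed
    have e_le: "norm (e k) \<le> norm ((2 ^ k) *\<^sub>R v k)" if "k \<le> m" for k
      using lipschitz_onD[OF S(1)[OF that, unfolded nonexpansive_def], of "a k x" "a k y"]
      by (simp add: e_def v_def dist_norm)
    have v_Suc: "(2 ^ Suc k) *\<^sub>R v (Suc k) = W (Suc k) ((2 ^ k) *\<^sub>R v k + e k)" if "Suc k \<le> m" for k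
    proof -
      have "v (Suc k) = W (Suc k) (?C k x - ?C k y)"
        by (simp add: v_def a_Suc linear_diff[OF lin[OF that]])
      then show ?thesis
        using out[of k] that by (simp add: linear_scale[OF lin[OF that], symmetric])
    qed
    have unroll: "(2 ^ k) *\<^sub>R v k = compose_range W 0 k \<delta> + (\<Sum>j<k. compose_range W (Suc j) k (e j))"
      if "k \<le> m" for k
      using that
    proof (induction k)
      case 0
      then show ?case
        using linear_diff[OF lin[of 0], of x y] by (simp add: v_def a_def compose_range_self \<delta>_def)
    next
      case (Suc k)
      have L: "linear (W (Suc k))" by (rule lin) (use Suc.prems in simp)
      have "(2 ^ Suc k) *\<^sub>R v (Suc k)
          = W (Suc k) (compose_range W 0 k \<delta> + (\<Sum>j<k. compose_range W (Suc j) k (e j)) + e k)"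
        using v_Suc[OF Suc.prems] Suc by simp
      also have "\<dots> = W (Suc k) (compose_range W 0 k \<delta>)
          + (\<Sum>j<k. W (Suc k) (compose_range W (Suc j) k (e j))) + W (Suc k) (e k)"
        by (simp add: linear_add[OF L] linear_sum[OF L])
      finally show ?case by (simp add: compose_range_Suc compose_range_empty)
    qed
    have bl: "bounded_linear (compose_range W l k)" if "l \<le> k" "k \<le> m" for l k
      unfolding linear_conv_bounded_linear[symmetric]
      by (rule linear_compose_range) (use that lin in auto)
    have tail: "norm (\<Sum>j<k. compose_range W (Suc j) k (e j))
        \<le> (\<Sum>j<k. theta_nat W j * onorm (compose_range W (Suc j) k)) * norm \<delta>"
      if "k \<le> m" "\<And>j. j < k \<Longrightarrow> norm (e j) \<le> theta_nat W j * norm \<delta>" for k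
      unfolding sum_distrib_right
    proof (rule order_trans[OF norm_sum sum_mono])
      fix j assume j: "j \<in> {..<k}"
      have B: "bounded_linear (compose_range W (Suc j) k)" using j that(1) by (intro bl) auto
      have "norm (compose_range W (Suc j) k (e j)) \<le> onorm (compose_range W (Suc j) k) * norm (e j)"
        by (rule onorm[OF B])
      also have "\<dots> \<le> onorm (compose_range W (Suc j) k) * (theta_nat W j * norm \<delta>)"
        using that(2)[of j] j by (intro mult_left_mono onorm_pos_le[OF B]) auto
      finally show "norm (compose_range W (Suc j) k (e j))
          \<le> theta_nat W j * onorm (compose_range W (Suc j) k) * norm \<delta>"
        by (simp add: mult_ac)
    qed
    have e_theta: "norm (e k) \<le> theta_nat W k * norm \<delta>" if "k \<le> m" for k
      using that
    proof (induction k rule: less_induct)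
      case (less k)
      have "norm (e k) \<le> norm (compose_range W 0 k \<delta> + (\<Sum>j<k. compose_range W (Suc j) k (e j)))"
        using e_le[OF less.prems] unroll[OF less.prems] by simp
      also have "\<dots> \<le> onorm (compose_range W 0 k) * norm \<delta>
          + (\<Sum>j<k. theta_nat W j * onorm (compose_range W (Suc j) k)) * norm \<delta>"
        by (rule norm_triangle_mono[OF onorm[OF bl] tail]) (use less in auto)
      also have "\<dots> = theta_nat W k * norm \<delta>"
        by (subst (2) theta_nat_rec) (simp add: distrib_right)
      finally show ?case .
    qed
    have "(2 ^ Suc m) *\<^sub>R ((?C m x - ?C m y) - (1 - \<alpha>) *\<^sub>R \<delta>)
        = (compose_range W 0 m \<delta> - ?c *\<^sub>R \<delta>) + (\<Sum>j<m. compose_range W (Suc j) m (e j)) + e m"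
      using out[of m] unroll[of m] by (simp add: scaleR_diff_right algebra_simps)
    also have "norm \<dots> \<le> M * norm \<delta>
        + (\<Sum>j<m. theta_nat W j * onorm (compose_range W (Suc j) m)) * norm \<delta> + theta_nat W m * norm \<delta>"
      by (intro norm_triangle_mono dist tail e_theta) auto
    also have "\<dots> = (M - onorm (compose_range W 0 m) + 2 * theta_nat W m) * norm \<delta>"
      using theta_nat_rec[of W m] by (simp add: algebra_simps)
    also have "\<dots> \<le> (2 ^ Suc m * \<alpha>) * norm \<delta>"
      by (rule mult_right_mono[OF bound]) simp
    finally have "2 ^ Suc m * norm ((?C m x - ?C m y) - (1 - \<alpha>) *\<^sub>R \<delta>) \<le> 2 ^ Suc m * (\<alpha> * norm \<delta>)"
      by (simp add: mult.assoc)
    then show ?thesis unfolding \<delta>_def by (rule mult_left_le_imp_le) simp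
  qed
  \<comment> \<open>the only candidate for the nonexpansive operator, as \<open>\<alpha> > 0\<close>\<close>
  define Q where "Q x = (1 / \<alpha>) *\<^sub>R (?C m x - (1 - \<alpha>) *\<^sub>R x)" for x
  have "nonexpansive Q"
    unfolding nonexpansive_def
  proof (rule lipschitz_onI)
    fix x y
    have "Q x - Q y = (1 / \<alpha>) *\<^sub>R ((?C m x - ?C m y) - (1 - \<alpha>) *\<^sub>R (x - y))"
      by (simp add: Q_def algebra_simps)
    then have "norm (Q x - Q y) = (1 / \<alpha>) * norm ((?C m x - ?C m y) - (1 - \<alpha>) *\<^sub>R (x - y))"
      using \<alpha> by simp
    also have "\<dots> \<le> (1 / \<alpha>) * (\<alpha> * norm (x - y))"
      using \<alpha> by (intro mult_left_mono estimate) auto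
    finally show "dist (Q x) (Q y) \<le> 1 * dist x y" using \<alpha> by (simp add: dist_norm)
  qed simp
  moreover have "?C m = (\<lambda>x. (1 - \<alpha>) *\<^sub>R x + \<alpha> *\<^sub>R Q x)"
    using \<alpha> by (auto simp: Q_def)
  ultimately show ?thesis using \<alpha> by (auto simp: averaged_def)
qed

section \<open>The forward-backward network\<close>

lemma transpose_gram: "transpose (transpose A ** A) = transpose A ** (A :: real^'n^'m)"
  by (simp add: matrix_transpose_mul)

theorem theorem1:
  fixes K r :: nat
    and y :: "real^'n"
    and H D :: "real^'n^'n"
    and P :: "'n \<Rightarrow> real^'n"
    and \<beta>H \<beta>D :: "'n \<Rightarrow> real"
    and \<mu> \<gamma> lam :: "nat \<Rightarrow> real"
    and c :: "nat \<Rightarrow> real^'n \<Rightarrow> ereal"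
    and W :: "nat \<Rightarrow> real^'n^'n"
    and b :: "nat \<Rightarrow> real^'n"
    and R :: "nat \<Rightarrow> real^'n \<Rightarrow> real^'n"
    and \<theta> :: "int \<Rightarrow> real"
    and \<beta> :: "nat \<Rightarrow> 'n \<Rightarrow> real"
    and \<alpha> \<beta>minus \<beta>plus :: real
  assumes "K \<ge> 1"
    and "diagonal_in_basis (transpose H ** H) P \<beta>H"
    and "diagonal_in_basis (transpose D ** D) P \<beta>D"
    and "\<And>k. k < K \<Longrightarrow> \<mu> k > 0 \<and> \<gamma> k > 0 \<and> lam k > 0"
    and "\<And>i. i \<in> {1..r} \<Longrightarrow> (\<lambda>x. - c i x) \<in> Gamma0"
    and "strict_interior r c \<noteq> {}"
    and "\<And>k. k < K \<Longrightarrow>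
           W k = mat 1 - \<gamma> k *\<^sub>R (transpose H ** H + lam k *\<^sub>R (transpose D ** D))"
    and "\<And>k. k < K \<Longrightarrow> b k = \<gamma> k *\<^sub>R (transpose H *v y)"
    and "\<And>k. k < K \<Longrightarrow> R k = prox (\<gamma> k * \<mu> k) (log_barrier r c)"
    and "\<And>k. -1 \<le> k \<Longrightarrow> k \<le> int K - 1 \<Longrightarrow> \<theta> k = theta (\<lambda>j. (*v) (W j)) k"
    and "1/2 \<le> \<alpha>" and "\<alpha> \<le> 1"
    and "\<beta>minus = Min (eigenvalues (compose_range (\<lambda>j. (*v) (W j)) 0 (K - 1)))"
    and "\<beta>plus = Max (eigenvalues (compose_range (\<lambda>j. (*v) (W j)) 0 (K - 1)))"
    and "\<And>k p. k < K \<Longrightarrow> \<beta> k p = 1 - \<gamma> k * (\<beta>H p + lam k * \<beta>D p)"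
  shows "\<beta>minus = (MIN p. \<Prod>k=0..K-1. \<beta> k p) \<and>
    \<beta>plus = (MAX p. \<Prod>k=0..K-1. \<beta> k p) \<and>
    (\<forall>k<K. \<theta> (int k) = (\<Sum>l=0..k. \<theta> (int l - 1) * (MAX q. \<bar>\<Prod>j=l..k. \<beta> j q\<bar>))) \<and>
    ((\<beta>plus + \<beta>minus \<le> 0 \<and> \<theta> (int K - 1) \<le> 2^(K-1) * (2 * \<alpha> - 1)) \<or>
     (0 \<le> \<beta>plus + \<beta>minus \<and> \<beta>plus + \<beta>minus \<le> 2^(K+1) * (1 - \<alpha>) \<and>
        2 * \<theta> (int K - 1) \<le> \<beta>plus + \<beta>minus + 2^K * (2 * \<alpha> - 1)) \<or>
     (2^(K+1) * (1 - \<alpha>) \<le> \<beta>plus + \<beta>minus \<and> \<theta> (int K - 1) \<le> 2^(K-1))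
     \<longrightarrow> averaged \<alpha> (compose_range (\<lambda>k. R k \<circ> (\<lambda>x. W k *v x + b k)) 0 (K - 1)))"
proof -
  note WK = assms(7) and beta_eq = assms(15)
  define A where "A j = (*v) (W j)" for j
  \<comment> \<open>\<open>d l k p\<close> is the eigenvalue of \<open>W k \<circ> \<dots> \<circ> W l\<close> at the vector \<open>P p\<close>.\<close>
  define d where "d l k p = (\<Prod>j=l..k. \<beta> j p)" for l k p
  have basis: "is_basis P" using assms(2) by (simp add: diagonal_in_basis_def)
  have layer: "symmetric_diagonal P (\<beta> k) (A k)" if "k < K" for k
    unfolding A_def
  proof (rule symmetric_diagonal_matrix)
    have "transpose (mat 1 - s *\<^sub>R (E + t *\<^sub>R F)) = mat 1 - s *\<^sub>R (transpose E + t *\<^sub>R transpose F)"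
      for s t and E F :: "real^'n^'n"
      by (auto simp: transpose_def vec_eq_iff mat_def)
    then show "transpose (W k) = W k" by (simp only: WK[OF that] transpose_gram)
    fix p
    have "(transpose H ** H) *v P p = \<beta>H p *\<^sub>R P p" "(transpose D ** D) *v P p = \<beta>D p *\<^sub>R P p"
      using assms(2,3) by (auto simp: diagonal_in_basis_def)
    then show "W k *v P p = \<beta> k p *\<^sub>R P p"
      unfolding WK[OF that] beta_eq[OF that]
      by (simp add: matrix_vector_mult_diff_rdistrib matrix_vector_mult_add_rdistrib
          scaleR_matrix_vector_assoc[symmetric] algebra_simps)
  qed
  have block: "symmetric_diagonal P (d l k) (compose_range A l k)" if "l \<le> k" "k < K" for l k
    using symmetric_diagonal_compose_range[OF basis that(1), of \<beta> A] layer that(2)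
    by (simp add: d_def[abs_def])
  have norm_block: "onorm (compose_range A l k) = (MAX q. \<bar>d l k q\<bar>)" if "l \<le> k" "k < K" for l k
    by (rule onorm_symmetric_diagonal[OF basis block[OF that]])
  define m where "m = K - 1"
  have K: "K = Suc m" using assms(1) by (simp add: m_def)
  have full: "symmetric_diagonal P (d 0 m) (compose_range A 0 m)" using block K by simp
  have minus: "\<beta>minus = (MIN p. d 0 m p)" and plus: "\<beta>plus = (MAX p. d 0 m p)"
    using assms(13,14) eigenvalues_diagonal[OF basis full] by (simp_all add: A_def[abs_def] m_def)
  have theta_eq: "\<theta> (int k) = theta_nat A k" if "k < K" for k
    using assms(10)[of "int k"] that by (simp add: theta_def A_def[abs_def])
  have theta_pred: "\<theta> (int K - 1) = theta_nat A m" using theta_eq[of m] K by simp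
  have recursion: "\<theta> (int k) = (\<Sum>l=0..k. \<theta> (int l - 1) * (MAX q. \<bar>d l k q\<bar>))" if "k < K" for k
  proof -
    \<comment> \<open>The term \<open>l = 0\<close> has the factor \<open>\<theta> (-1) = 1\<close> and is the norm of the full product; the term
      \<open>l = j + 1\<close> is the term \<open>j\<close> of the recursion.\<close>
    have "\<theta> (- 1) = 1" using assms(10)[of "- 1"] by (simp add: theta_def)
    then have "(\<Sum>l=0..k. \<theta> (int l - 1) * (MAX q. \<bar>d l k q\<bar>))
        = (MAX q. \<bar>d 0 k q\<bar>) + (\<Sum>j<k. \<theta> (int j) * (MAX q. \<bar>d (Suc j) k q\<bar>))"
      by (simp add: atMost_atLeast0[symmetric] sum.atMost_shift)
    also have "\<dots> = onorm (compose_range A 0 k) + (\<Sum>j<k. theta_nat A j * onorm (compose_range A (Suc j) k))"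
      using that by (simp add: norm_block theta_eq)
    also have "\<dots> = \<theta> (int k)" using theta_nat_rec[of A k] theta_eq[OF that] by simp
    finally show ?thesis by simp
  qed
  have averaged: "averaged \<alpha> (compose_range (\<lambda>k. R k \<circ> (\<lambda>x. W k *v x + b k)) 0 (K - 1))"
    if cond: "(\<beta>plus + \<beta>minus \<le> 0 \<and> \<theta> (int K - 1) \<le> 2^(K-1) * (2 * \<alpha> - 1)) \<or>
     (0 \<le> \<beta>plus + \<beta>minus \<and> \<beta>plus + \<beta>minus \<le> 2^(K+1) * (1 - \<alpha>) \<and>
        2 * \<theta> (int K - 1) \<le> \<beta>plus + \<beta>minus + 2^K * (2 * \<alpha> - 1)) \<or>
     (2^(K+1) * (1 - \<alpha>) \<le> \<beta>plus + \<beta>minus \<and> \<theta> (int K - 1) \<le> 2^(K-1))"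
  proof -
    let ?c = "2 ^ Suc m * (1 - \<alpha>)"
    \<comment> \<open>\<open>compose_range A 0 m\<close> minus \<open>?c\<close> times the identity has its eigenvalues between
      \<open>\<beta>minus - ?c\<close> and \<open>\<beta>plus - ?c\<close>.\<close>
    define M where "M = max \<bar>\<beta>plus - ?c\<bar> \<bar>\<beta>minus - ?c\<bar>"
    have between: "\<beta>minus \<le> d 0 m p" "d 0 m p \<le> \<beta>plus" for p
      unfolding minus plus by (auto intro: Min_le Max_ge)
    have "\<bar>d 0 m p - ?c\<bar> \<le> M" for p
      using between[of p] unfolding M_def by linarith
    then have dist: "norm (compose_range A 0 m x - ?c *\<^sub>R x) \<le> M * norm x" for x
      using norm_symmetric_diagonal_le[OF basis symmetric_diagonal_shift[OF full]] by blast
    have "\<beta>minus \<in> range (d 0 m)" "\<beta>plus \<in> range (d 0 m)"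
      unfolding minus plus by (auto intro!: Min_in Max_in simp del: image_iff)
    then have norm_ge: "\<bar>\<beta>minus\<bar> \<le> onorm (compose_range A 0 m)" "\<bar>\<beta>plus\<bar> \<le> onorm (compose_range A 0 m)"
      using norm_block[of 0 m] K by (auto intro!: Max_ge)
    have "?c \<ge> 0" using assms(12) by simp
    have le: "\<beta>minus \<le> \<beta>plus" using between by (rule order_trans)
    have pow: "(2::real) ^ (K + 1) * (1 - \<alpha>) = 2 * ?c" "(2::real) ^ K * (2 * \<alpha> - 1) = 2 ^ Suc m * \<alpha> - ?c"
      "2 * (2 ^ (K - 1) * (2 * \<alpha> - 1)) = 2 ^ Suc m * \<alpha> - ?c" "2 * (2::real) ^ (K - 1) = 2 ^ Suc m * \<alpha> + ?c"
      by (simp_all add: K algebra_simps)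
    have "M - onorm (compose_range A 0 m) + 2 * theta_nat A m \<le> 2 ^ Suc m * \<alpha>"
      using cond
    proof (elim disjE conjE)
      assume neg: "\<beta>plus + \<beta>minus \<le> 0" and th: "\<theta> (int K - 1) \<le> 2^(K-1) * (2 * \<alpha> - 1)"
      have "M = ?c - \<beta>minus" using neg le \<open>?c \<ge> 0\<close> unfolding M_def by linarith
      then show ?thesis using th norm_ge pow(3) unfolding theta_pred by linarith
    next
      assume mid: "0 \<le> \<beta>plus + \<beta>minus" "\<beta>plus + \<beta>minus \<le> 2^(K+1) * (1 - \<alpha>)"
        and th: "2 * \<theta> (int K - 1) \<le> \<beta>plus + \<beta>minus + 2^K * (2 * \<alpha> - 1)"
      have "M = ?c - \<beta>minus" using mid le \<open>?c \<ge> 0\<close> unfolding M_def pow(1) by linarith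
      then show ?thesis using th norm_ge pow(2) unfolding theta_pred by linarith
    next
      assume big: "2^(K+1) * (1 - \<alpha>) \<le> \<beta>plus + \<beta>minus" and th: "\<theta> (int K - 1) \<le> 2^(K-1)"
      have "M = \<beta>plus - ?c" using big le \<open>?c \<ge> 0\<close> unfolding M_def pow(1) by linarith
      then show ?thesis using th norm_ge pow(4) unfolding theta_pred by linarith
    qed
    moreover have "averaged (1/2) (R k)" if "k \<le> m" for k
      using assms(4)[of k] assms(9)[of k] that K
      by (auto intro!: prox_averaged log_barrier_Gamma0 assms(5,6))
    moreover have "linear (A k)" for k by (simp add: A_def)
    ultimately have "averaged \<alpha> (compose_range (\<lambda>k. R k \<circ> (\<lambda>x. A k x + b k)) 0 m)"
      using dist assms(11,12) by (intro layers_averaged) auto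
    then show ?thesis by (simp add: A_def m_def)
  qed
  show ?thesis
    using minus plus recursion averaged unfolding d_def m_def by blast
qed

end
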